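(* Suppose that for each $n\ge 0$ there exists a constant $\beta_n\in[0,1)$ such that $p_n(D\mid i,\bm{a})\ge\beta_n$ for all $i\in S_n\setminus D$ and $\bm{a}\in\bm{A}_n(i)$, and suppose that $\sum_{n=0}^{\infty}\beta_n=+\infty$. Then Assumption A holds, that is: for every initial distribution $\gamma$, every multipolicy $\bm{\pi}\in\bm{\Pi}$, every $n\ge0$ and every $h_n=(i_0,\bm{\lambda}_0,\bm{a}_0,\ldots,i_n,\bm{\lambda}_n)\in\mathbb{H}_n$ with $i_n\in S_n\setminus D$ and $\mathbb{P}^{\bm{\pi}}_\gamma(H_n=h_n)>0$, $$\mathbb{P}^{\bm{\pi}}_\gamma(\tau_D^n<\infty\mid H_n=h_n)=1 .$$
   Context: Game model. $I=\{1,\ldots,N\}$ is a finite set of players and $\mathbb{N}_0=\{0,1,\ldots\}$. For each $n\in\mathbb{N}_0$: $S_n$ is a denumerable state space; $A_n^k$ is the action space of player $k$ and $A_n^k(i)\subseteq A_n^k$ is the finite nonempty set of actions available to player $k$ in state $i\in S_n$; $\bm{A}_n(i)=\prod_{k=1}^N A_n^k(i)$; $p_n(\cdot\mid i,\bm{a})$ is a probability distribution on $S_{n+1}$ for each $i\in S_n$, $\bm{a}\in\bm{A}_n(i)$; $r_n^k(i,\bm{a})\ge 0$ is a rational-valued reward of player $k$, and $\bm{r}_n=(r_n^1,\ldots,r_n^N)$. The target set $D$ is a nonempty subset of $\bigcap_{n}S_n$, and $p_n(D\mid i,\bm a)=\sum_{j\in D}p_n(j\mid i,\bm a)$. Histories: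 $\mathbb{H}_0=S_0\times\mathbb{Q}^N$, and $\mathbb{H}_n=\{(h_{n-1},\bm{a}_{n-1},i_n,\bm{\lambda}_n): h_{n-1}\in\mathbb{H}_{n-1}$ (with last state $i_{n-1}$), $\bm{a}_{n-1}\in\bm{A}_{n-1}(i_{n-1}),\ i_n\in S_n,\ \bm{\lambda}_n\in\mathbb{Q}^N\}$ for $n\ge1$. Policies: a (randomized history-dependent) policy of player $k$ is a sequence $\pi^k=\{\pi^k_n\}_{n\ge0}$ of stochastic kernels on $A_n^k$ given $\mathbb{H}_n$ with $\pi_n^k(A_n^k(i_n)\mid h_n)=1$, where $i_n$ is the last state of $h_n$. $\Pi^k$ is the set of these, and $\bm{\Pi}=\prod_k\Pi^k$. For an initial distribution $\gamma$ on $S_0\times\mathbb{Q}^N$ and $\bm{\pi}\in\bm{\Pi}$, $\mathbb{P}_\gamma^{\bm\pi}$ is the (Ionescu-Tulcea) law of the process $\{X_n,\bm{\Lambda}_n,Y_n\}_{n\ge0}$ (state, vector of remaining goals, action vector) with $(X_0,\bm\Lambda_0)\sim\gamma$ and, writing $H_n=(X_0,\bm\Lambda_0,Y_0,\ldots,X_n,\bm\Lambda_n)$: given $H_n=h_n$ the players choose $Y_n=(a^1,\ldots,a^N)$ with probability $\prod_k\pi^k_n(a^k\mid h_n)$; then $\bm\Lambda_{n+1}=\bm\Lambda_n-\bm{r}_n(X_n,Y_n)$ and $X_{n+1}\sim p_n(\cdot\mid X_n,Y_n)$. $\tau_D^n=\inf\{k\ge n: X_k\in D\}$, with $\inf\emptyset=\infty$.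 *)

theory Defs
  imports "HOL-Probability.Probability"
begin

text \<open>
  The players are the elements of a finite type \<open>'p\<close>, so a tuple with one entry per player is a
  function on \<open>'p\<close>. States and actions of all stages and players live in common types
  \<open>'s\<close> and \<open>'a\<close>, which carry no structure. The fields \<open>act_space G n k\<close>, \<open>avail G n k i\<close>,
  \<open>transition G n i a\<close> and \<open>reward G n k i a\<close> stand for $A_n^k$, $A_n^k(i)$, $p_n(\cdot\mid i,a)$ and
  $r_n^k(i,a)$.
\<close>

record ('s, 'a, 'p) game =
  states :: "nat \<Rightarrow> 's set"
  act_space :: "nat \<Rightarrow> 'p \<Rightarrow> 'a set"
  avail :: "nat \<Rightarrow> 'p \<Rightarrow> 's \<Rightarrow> 'a set"
  transition :: "nat \<Rightarrow> 's \<Rightarrow> ('p \<Rightarrow> 'a) \<Rightarrow> 's pmf"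
  reward :: "nat \<Rightarrow> 'p \<Rightarrow> 's \<Rightarrow> ('p \<Rightarrow> 'a) \<Rightarrow> rat"
  target :: "'s set"

definition actions :: "('s, 'a, 'p) game \<Rightarrow> nat \<Rightarrow> 's \<Rightarrow> ('p \<Rightarrow> 'a) set" where
  "actions G n i = (\<Pi>\<^sub>E k\<in>UNIV. avail G n k i)"

locale stochastic_game =
  fixes G :: "('s, 'a, 'p :: finite) game"
  assumes countable_states: "countable (states G n)"
    and avail_subset: "i \<in> states G n \<Longrightarrow> avail G n k i \<subseteq> act_space G n k"
    and finite_avail: "i \<in> states G n \<Longrightarrow> finite (avail G n k i)"
    and avail_nonempty: "i \<in> states G n \<Longrightarrow> avail G n k i \<noteq> {}"
    and transition_states: "i \<in> states G n \<Longrightarrow> a \<in> actions G n i \<Longrightarrow>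
      measure_pmf.prob (transition G n i a) (states G (Suc n)) = 1"
    and reward_nonneg: "i \<in> states G n \<Longrightarrow> a \<in> actions G n i \<Longrightarrow> 0 \<le> reward G n k i a"
    and target_nonempty: "target G \<noteq> {}"
    and target_subset: "target G \<subseteq> (\<Inter>n. states G n)"

datatype ('s, 'a, 'p) history =
    Start 's "'p \<Rightarrow> rat"
  | Extend "('s, 'a, 'p) history" "'p \<Rightarrow> 'a" 's "'p \<Rightarrow> rat"

primrec last_state :: "('s, 'a, 'p) history \<Rightarrow> 's" where
  "last_state (Start i l) = i"
| "last_state (Extend h a i l) = i"

primrec histories :: "('s, 'a, 'p) game \<Rightarrow> nat \<Rightarrow> ('s, 'a, 'p) history set" where
  "histories G 0 = {Start i l | i l. i \<in> states G 0}"
| "histories G (Suc n) = {Extend h a i l | h a i l.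
     h \<in> histories G n \<and> a \<in> actions G n (last_state h) \<and> i \<in> states G (Suc n)}"

text \<open>
  Admissible actions form finite sets, so a stochastic kernel that is concentrated on them is a
  family of discrete distributions; since there are only countably many histories, its
  measurability in the history is automatic. The values of a policy outside the set of histories
  are irrelevant and unconstrained.
\<close>

type_synonym ('s, 'a, 'p) policy = "nat \<Rightarrow> ('s, 'a, 'p) history \<Rightarrow> 'a pmf"

definition policies :: "('s, 'a, 'p) game \<Rightarrow> 'p \<Rightarrow> ('s, 'a, 'p) policy set" where
  "policies G k = {\<sigma>. \<forall>n. \<forall>h\<in>histories G n.
     measure_pmf.prob (\<sigma> n h) (avail G n k (last_state h)) = 1}"

definition multipolicies :: "('s, 'a, 'p) game \<Rightarrow> ('p \<Rightarrow> ('s, 'a, 'p) policy) set" where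
  "multipolicies G = (\<Pi>\<^sub>E k\<in>UNIV. policies G k)"

definition initial_distributions :: "('s, 'a, 'p) game \<Rightarrow> ('s \<times> ('p \<Rightarrow> rat)) pmf set" where
  "initial_distributions G = {\<gamma>. measure_pmf.prob \<gamma> (states G 0 \<times> UNIV) = 1}"

text \<open>A trajectory lists the state, the remaining goals and the action vector of every stage.\<close>

type_synonym ('s, 'a, 'p) trajectory = "nat \<Rightarrow> 's \<times> ('p \<Rightarrow> rat) \<times> ('p \<Rightarrow> 'a)"

definition state_at :: "nat \<Rightarrow> ('s, 'a, 'p) trajectory \<Rightarrow> 's" where
  "state_at n \<omega> = fst (\<omega> n)"

definition goals_at :: "nat \<Rightarrow> ('s, 'a, 'p) trajectory \<Rightarrow> 'p \<Rightarrow> rat" where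
  "goals_at n \<omega> = fst (snd (\<omega> n))"

definition action_at :: "nat \<Rightarrow> ('s, 'a, 'p) trajectory \<Rightarrow> 'p \<Rightarrow> 'a" where
  "action_at n \<omega> = snd (snd (\<omega> n))"

primrec history_at :: "nat \<Rightarrow> ('s, 'a, 'p) trajectory \<Rightarrow> ('s, 'a, 'p) history" where
  "history_at 0 \<omega> = Start (state_at 0 \<omega>) (goals_at 0 \<omega>)"
| "history_at (Suc n) \<omega> =
     Extend (history_at n \<omega>) (action_at n \<omega>) (state_at (Suc n) \<omega>) (goals_at (Suc n) \<omega>)"

text \<open>
  The players randomize independently; the second argument of \<^const>\<open>Pi_pmf\<close> is the value outside
  the index set, which plays no role for the index set \<^term>\<open>UNIV\<close>.
\<close>

definition joint_action ::
    "('p :: finite \<Rightarrow> ('s, 'a, 'p) policy) \<Rightarrow> nat \<Rightarrow> ('s, 'a, 'p) history \<Rightarrow> ('p \<Rightarrow> 'a) pmf" where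
  "joint_action \<pi> n h = Pi_pmf UNIV undefined (\<lambda>k. \<pi> k n h)"

text \<open>Conditional distribution of the stage-\<open>n\<close> triple, given the triples of the stages before.\<close>

primrec step :: "('s, 'a, 'p :: finite) game \<Rightarrow> ('s \<times> ('p \<Rightarrow> rat)) pmf \<Rightarrow>
    ('p \<Rightarrow> ('s, 'a, 'p) policy) \<Rightarrow> nat \<Rightarrow> ('s, 'a, 'p) trajectory \<Rightarrow>
    ('s \<times> ('p \<Rightarrow> rat) \<times> ('p \<Rightarrow> 'a)) pmf" where
  "step G \<gamma> \<pi> 0 \<omega> =
     bind_pmf \<gamma> (\<lambda>(i, l).
     bind_pmf (joint_action \<pi> 0 (Start i l)) (\<lambda>a.
     return_pmf (i, l, a)))"
| "step G \<gamma> \<pi> (Suc n) \<omega> =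
     (let l = (\<lambda>k. goals_at n \<omega> k - reward G n k (state_at n \<omega>) (action_at n \<omega>)) in
      bind_pmf (transition G n (state_at n \<omega>) (action_at n \<omega>)) (\<lambda>i.
      bind_pmf (joint_action \<pi> (Suc n) (Extend (history_at n \<omega>) (action_at n \<omega>) i l)) (\<lambda>a.
      return_pmf (i, l, a))))"

text \<open>
  The triples that can occur at stage \<open>n\<close> form a countable set. Restricting the distributions to
  these sets puts the process on a product of countable discrete spaces, where measurability of
  the kernels is automatic.
\<close>

definition triples :: "('s, 'a, 'p) game \<Rightarrow> nat \<Rightarrow> ('s \<times> ('p \<Rightarrow> rat) \<times> ('p \<Rightarrow> 'a)) set" where
  "triples G n = {(i, l, a). i \<in> states G n \<and> a \<in> actions G n i}"

definition triple_space ::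
    "('s, 'a, 'p) game \<Rightarrow> nat \<Rightarrow> ('s \<times> ('p \<Rightarrow> rat) \<times> ('p \<Rightarrow> 'a)) measure" where
  "triple_space G n = count_space (triples G n)"

definition step_kernel :: "('s, 'a, 'p :: finite) game \<Rightarrow> ('s \<times> ('p \<Rightarrow> rat)) pmf \<Rightarrow>
    ('p \<Rightarrow> ('s, 'a, 'p) policy) \<Rightarrow> nat \<Rightarrow> ('s, 'a, 'p) trajectory \<Rightarrow>
    ('s \<times> ('p \<Rightarrow> rat) \<times> ('p \<Rightarrow> 'a)) measure" where
  "step_kernel G \<gamma> \<pi> n \<omega> = restrict_space (measure_pmf (step G \<gamma> \<pi> n \<omega>)) (triples G n)"

text \<open>
  The Ionescu-Tulcea measure of the kernels. The theorem \<open>stochastic_game.ionescu_tulcea_steps\<close>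
  below provides the conditions under which the library constructs this limit.
\<close>

definition law :: "('s, 'a, 'p :: finite) game \<Rightarrow> ('s \<times> ('p \<Rightarrow> rat)) pmf \<Rightarrow>
    ('p \<Rightarrow> ('s, 'a, 'p) policy) \<Rightarrow> ('s, 'a, 'p) trajectory measure" where
  "law G \<gamma> \<pi> = projective_family.lim UNIV
     (Ionescu_Tulcea.CI (step_kernel G \<gamma> \<pi>) (triple_space G)) (triple_space G)"

text \<open>In \<^typ>\<open>enat\<close> the infimum of the empty set is \<open>\<infinity>\<close>.\<close>

definition hitting_time :: "('s, 'a, 'p) game \<Rightarrow> nat \<Rightarrow> ('s, 'a, 'p) trajectory \<Rightarrow> enat" where
  "hitting_time G n \<omega> = Inf (enat ` {m. n \<le> m \<and> state_at m \<omega> \<in> target G})"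

context stochastic_game
begin

lemma finite_actions: "i \<in> states G n \<Longrightarrow> finite (actions G n i)"
  unfolding actions_def by (intro finite_PiE) (auto intro: finite_avail)

lemma countable_triples: "countable (triples G n)"
proof -
  have "triples G n = (SIGMA i:states G n. UNIV \<times> actions G n i)"
    by (auto simp: triples_def)
  then show ?thesis
    by (simp add: countable_SIGMA countable_states countable_finite finite_actions)
qed

lemma transition_in_states:
  assumes "i \<in> states G n" "a \<in> actions G n i" "j \<in> set_pmf (transition G n i a)"
  shows "j \<in> states G (Suc n)"
  using transition_states[OF assms(1,2)] assms(3)
  by (auto simp: measure_pmf.prob_eq_1 AE_measure_pmf_iff)

lemma joint_action_in_actions:
  assumes "\<pi> \<in> multipolicies G" "h \<in> histories G n" "a \<in> set_pmf (joint_action \<pi> n h)"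
  shows "a \<in> actions G n (last_state h)"
proof -
  have "a k \<in> avail G n k (last_state h)" for k
  proof -
    have "measure_pmf.prob (\<pi> k n h) (avail G n k (last_state h)) = 1"
      using assms(1,2) by (auto simp: multipolicies_def policies_def PiE_iff)
    moreover have "a k \<in> set_pmf (\<pi> k n h)"
      using assms(3) by (auto simp: joint_action_def set_Pi_pmf PiE_dflt_def)
    ultimately show ?thesis
      by (auto simp: measure_pmf.prob_eq_1 AE_measure_pmf_iff)
  qed
  then show ?thesis
    by (simp add: actions_def PiE_iff)
qed

lemma last_state_history_at [simp]: "last_state (history_at n \<omega>) = state_at n \<omega>"
  by (cases n) auto

lemma history_at_in_histories:
  assumes "\<And>m. m \<le> n \<Longrightarrow> \<omega> m \<in> triples G m"
  shows "history_at n \<omega> \<in> histories G n"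
  using assms
proof (induction n)
  case 0
  from 0[of 0] show ?case
    by (auto simp: triples_def state_at_def)
next
  case (Suc n)
  have "history_at n \<omega> \<in> histories G n"
    using Suc by simp
  moreover have "\<omega> n \<in> triples G n" "\<omega> (Suc n) \<in> triples G (Suc n)"
    using Suc.prems by auto
  ultimately show ?case
    by (auto simp: triples_def state_at_def action_at_def)
qed

lemma step_in_triples:
  assumes "\<gamma> \<in> initial_distributions G" "\<pi> \<in> multipolicies G"
    and \<omega>: "\<And>m. m < n \<Longrightarrow> \<omega> m \<in> triples G m"
  shows "set_pmf (step G \<gamma> \<pi> n \<omega>) \<subseteq> triples G n"
proof (cases n)
  case 0
  have "i \<in> states G 0" if "(i, l) \<in> set_pmf \<gamma>" for i l
    using assms(1) that
    by (auto simp: initial_distributions_def measure_pmf.prob_eq_1 AE_measure_pmf_iff)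
  then show ?thesis
    using joint_action_in_actions[OF assms(2), where n = 0] 0
    by (fastforce simp: triples_def)
next
  case (Suc m)
  have h: "history_at m \<omega> \<in> histories G m"
    by (rule history_at_in_histories) (use \<omega> Suc in auto)
  have m: "state_at m \<omega> \<in> states G m" "action_at m \<omega> \<in> actions G m (state_at m \<omega>)"
    using \<omega>[of m] Suc by (auto simp: triples_def state_at_def action_at_def)
  have ext: "Extend (history_at m \<omega>) (action_at m \<omega>) i l \<in> histories G (Suc m)"
    if "i \<in> states G (Suc m)" for i l
    using h m that by auto
  show ?thesis
    using transition_in_states[OF m] joint_action_in_actions[OF assms(2) ext] Suc
    by (fastforce simp: triples_def Let_def)
qed

theorem ionescu_tulcea_steps:
  assumes "\<gamma> \<in> initial_distributions G" "\<pi> \<in> multipolicies G"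
  shows "Ionescu_Tulcea (step_kernel G \<gamma> \<pi>) (triple_space G)"
proof (rule Ionescu_Tulcea.intro)
  have sp: "PiM {0..<n} (triple_space G) = count_space (PiE {0..<n} (triples G))" for n
    unfolding triple_space_def
    by (intro count_space_PiM_finite) (auto simp: countable_triples)
  have prob: "prob_space (step_kernel G \<gamma> \<pi> n \<omega>)"
    if "\<omega> \<in> space (PiM {0..<n} (triple_space G))" for n \<omega>
  proof -
    have "set_pmf (step G \<gamma> \<pi> n \<omega>) \<subseteq> triples G n"
      by (rule step_in_triples[OF assms]) (use that in \<open>auto simp: sp PiE_iff\<close>)
    then have "emeasure (measure_pmf (step G \<gamma> \<pi> n \<omega>)) (triples G n) = 1"
      by (intro measure_pmf.emeasure_eq_1_AE) (auto simp: AE_measure_pmf_iff)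
    then show ?thesis
      unfolding step_kernel_def by (intro prob_space_restrict_space) auto
  qed
  have sets: "sets (step_kernel G \<gamma> \<pi> n \<omega>) = sets (triple_space G n)" for n \<omega>
    by (auto simp: step_kernel_def triple_space_def sets_restrict_space)
  show "step_kernel G \<gamma> \<pi> n \<in> measurable (PiM {0..<n} (triple_space G))
      (subprob_algebra (triple_space G n))" for n
    using prob[of _ n] sets[of n]
    by (auto simp: sp space_subprob_algebra intro!: prob_space_imp_subprob_space)
  show "prob_space (step_kernel G \<gamma> \<pi> n \<omega>)"
    if "\<omega> \<in> space (PiM {0..<n} (triple_space G))" for n \<omega>
    using that by (rule prob)
qed

end

end

theory Submission
  imports Defs
begin

text \<open>
  Fix a history \<open>h\<close> of stage \<open>n\<close> and let \<open>q m\<close>, for \<open>m \<ge> n\<close>, be the probability that the process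
  follows \<open>h\<close> up to stage \<open>n\<close> and avoids the target at all stages \<open>n, \<dots>, m\<close>. This event
  is decided by the first \<open>m + 1\<close> triples. On it the state of stage \<open>m\<close> lies outside the target,
  so whatever actions are played there, the next state lies in the target with conditional
  probability at least \<open>\<beta> m\<close>. Hence \<open>q (Suc m) \<le> (1 - \<beta> m) * q m\<close>, and with \<open>1 - t \<le> exp (- t)\<close>
  this gives \<open>q m \<le> exp (- (\<Sum>k=n..<m. \<beta> k)) * q n\<close>, which tends to \<open>0\<close> since the series diverges.
  A trajectory that follows \<open>h\<close> and never hits the target afterwards belongs to all these events,
  so such trajectories form a null set; given \<open>h\<close>, the target is hit almost surely.

  The probabilistic input is the one-step estimate for an Ionescu-Tulcea limit,
  \<open>Ionescu_Tulcea.emeasure_lim_Suc_le\<close>, which \<open>measure_law_Suc_le\<close> restates for the process of the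
  game. The decay of \<open>q\<close> is the purely analytic \<open>tendsto_0_if_contraction_divergent\<close>.
\<close>

section \<open>One-step estimates for Ionescu-Tulcea limits\<close>

lemma (in Ionescu_Tulcea) emeasure_lim_emb_initial:
  assumes "X \<in> sets (PiM {0..<n} M)"
  shows "emeasure PF.lim (PF.emb UNIV {0..<n} X) = emeasure (C 0 n (\<lambda>_. undefined)) X"
proof -
  have "PF.emb {0..<n} {0..<n} X = X"
    using sets.sets_into_space[OF assms] by (intro prod_emb_id) (auto simp: space_PiM)
  then show ?thesis
    using assms by (simp add: lim emeasure_CI[of _ n])
qed

lemma (in Ionescu_Tulcea) prob_space_lim: "prob_space PF.lim"
proof (rule prob_spaceI)
  \<comment> \<open>The whole space is the cylinder over the empty set of coordinates.\<close>
  have *: "PF.emb UNIV {0..<0} (space (PiM {0..<0} M)) = space PF.lim"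
    by (auto simp: prod_emb_def space_PiM)
  interpret C: prob_space "C 0 0 (\<lambda>_. undefined)"
    by (rule prob_space_C) simp
  have "space (C 0 0 (\<lambda>_. undefined)) = space (PiM {0..<0} M)"
    by (subst space_C) auto
  then show "emeasure PF.lim (space PF.lim) = 1"
    using C.emeasure_space_1 by (subst *[symmetric], subst emeasure_lim_emb_initial) auto
qed

text \<open>
  The law of the first \<open>n + 1\<close> coordinates integrates the kernel of coordinate \<open>n\<close> against the law
  of the first \<open>n\<close> coordinates. Since \<open>Y\<close> has no sections over points outside \<open>X\<close>, only \<open>X\<close>
  contributes to the integral.
\<close>

lemma (in Ionescu_Tulcea) emeasure_lim_Suc_le:
  assumes X[measurable]: "X \<in> sets (PiM {0..<n} M)"
    and Y[measurable]: "Y \<in> sets (PiM {0..<Suc n} M)"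
    and sub: "\<And>x y. x \<in> space (PiM {0..<n} M) \<Longrightarrow> y \<in> space (M n) \<Longrightarrow>
      x(n := y) \<in> Y \<Longrightarrow> x \<in> X"
    and le: "\<And>x. x \<in> X \<Longrightarrow> emeasure (P n x) {y \<in> space (M n). x(n := y) \<in> Y} \<le> c"
  shows "emeasure PF.lim (PF.emb UNIV {0..<Suc n} Y)
    \<le> c * emeasure PF.lim (PF.emb UNIV {0..<n} X)"
proof -
  let ?C = "C 0 n (\<lambda>_. undefined)"
  have sp: "space ?C = space (PiM {0..<n} M)" and st: "sets ?C = sets (PiM {0..<n} M)"
    by (simp_all add: space_C sets_C)
  have "emeasure PF.lim (PF.emb UNIV {0..<Suc n} Y) = emeasure (?C \<bind> eP n) Y"
    by (simp add: emeasure_lim_emb_initial)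
  also have "\<dots> = (\<integral>\<^sup>+x. emeasure (eP n x) Y \<partial>?C)"
  proof (rule emeasure_bind[OF _ _ Y])
    show "space ?C \<noteq> {}"
      unfolding sp by (auto simp: space_PiM_empty_iff)
    show "eP n \<in> measurable ?C (subprob_algebra (PiM {0..<Suc n} M))"
      using measurable_eP[of n] by (simp add: measurable_cong_sets[OF st refl])
  qed
  also have "\<dots> \<le> (\<integral>\<^sup>+x. c * indicator X x \<partial>?C)"
  proof (rule nn_integral_mono)
    fix x assume "x \<in> space ?C"
    then have x: "x \<in> space (PiM {0..<n} M)"
      by (simp add: sp)
    have eq: "emeasure (eP n x) Y = emeasure (P n x) {y \<in> space (M n). x(n := y) \<in> Y}"
      using x by (subst emeasure_eP) (auto intro!: arg_cong[where f="emeasure (P n x)"])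
    show "emeasure (eP n x) Y \<le> c * indicator X x"
    proof (cases "x \<in> X")
      case True
      then show ?thesis
        using le[of x] eq by simp
    next
      case False
      then have "{y \<in> space (M n). x(n := y) \<in> Y} = {}"
        using sub[OF x] by auto
      then show ?thesis
        using eq by (metis emeasure_empty zero_le)
    qed
  qed
  also have "\<dots> = c * emeasure ?C X"
    by (intro nn_integral_cmult_indicator) (simp add: st)
  also have "\<dots> = c * emeasure PF.lim (PF.emb UNIV {0..<n} X)"
    by (simp add: emeasure_lim_emb_initial)
  finally show ?thesis .
qed

section \<open>Decay under divergent contraction rates\<close>

lemma tendsto_0_if_contraction_divergent:
  fixes q \<beta> :: "nat \<Rightarrow> real"
  assumes nonneg: "\<And>m. n \<le> m \<Longrightarrow> 0 \<le> q m"
    and contract: "\<And>m. n \<le> m \<Longrightarrow> q (Suc m) \<le> (1 - \<beta> m) * q m"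
    and diverge: "filterlim (\<lambda>m. \<Sum>k<m. \<beta> k) at_top sequentially"
  shows "q \<longlonglongrightarrow> 0"
proof -
  define S where "S m = (\<Sum>k<m. \<beta> k)" for m
  have le: "q m \<le> exp (S n - S m) * q n" if "n \<le> m" for m
    using that
  proof (induction rule: dec_induct)
    case base
    show ?case by simp
  next
    case (step m)
    have "q (Suc m) \<le> (1 - \<beta> m) * q m"
      using contract step by simp
    also have "\<dots> \<le> exp (- \<beta> m) * q m"
      using exp_ge_add_one_self[of "- \<beta> m"] nonneg step by (intro mult_right_mono) auto
    also have "\<dots> \<le> exp (- \<beta> m) * (exp (S n - S m) * q n)"
      using step by (intro mult_left_mono) auto
    also have "\<dots> = exp (S n - S (Suc m)) * q n"
      by (simp add: S_def exp_add[symmetric] mult.assoc[symmetric] algebra_simps)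
    finally show ?case .
  qed
  have "filterlim (\<lambda>m. - S m) at_bot sequentially"
    using diverge by (simp add: S_def filterlim_uminus_at_bot)
  then have "(\<lambda>m. exp (- S m)) \<longlonglongrightarrow> 0"
    by (rule filterlim_compose[OF exp_at_bot])
  then have "(\<lambda>m. (exp (S n) * q n) * exp (- S m)) \<longlonglongrightarrow> (exp (S n) * q n) * 0"
    by (intro tendsto_intros)
  then have "(\<lambda>m. exp (S n - S m) * q n) \<longlonglongrightarrow> 0"
    by (simp add: exp_diff exp_minus field_simps)
  then show ?thesis
    by (rule tendsto_sandwich[OF _ _ tendsto_const, rotated 2])
      (auto simp: eventually_sequentially intro!: exI[of _ n] nonneg le)
qed

lemma partial_sums_at_top_if_suminf_ennreal:
  fixes \<beta> :: "nat \<Rightarrow> real"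
  assumes "\<And>n. 0 \<le> \<beta> n" "(\<Sum>n. ennreal (\<beta> n)) = \<infinity>"
  shows "filterlim (\<lambda>m. \<Sum>k<m. \<beta> k) at_top sequentially"
proof -
  have "(\<lambda>m. \<Sum>k<m. ennreal (\<beta> k)) \<longlonglongrightarrow> (\<Sum>n. ennreal (\<beta> n))"
    by (rule summable_LIMSEQ) simp
  then have "(\<lambda>m. ennreal (\<Sum>k<m. \<beta> k)) \<longlonglongrightarrow> top"
    using assms by (simp add: sum_ennreal)
  then show ?thesis
    by (simp add: ennreal_tendsto_top_eq_at_top)
qed

section \<open>Events decided by finitely many stages\<close>

lemma history_at_cong:
  "(\<And>k. k \<le> n \<Longrightarrow> \<omega> k = \<omega>' k) \<Longrightarrow> history_at n \<omega> = history_at n \<omega>'"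
  by (induction n) (auto simp: state_at_def goals_at_def action_at_def)

context stochastic_game
begin

lemma PiM_triple_space:
  "PiM {0..<n} (triple_space G) = count_space (PiE {0..<n} (triples G))"
  unfolding triple_space_def by (intro count_space_PiM_finite) (auto simp: countable_triples)

context
  fixes \<gamma> \<pi>
  assumes \<gamma>: "\<gamma> \<in> initial_distributions G" and \<pi>: "\<pi> \<in> multipolicies G"
begin

interpretation IT: Ionescu_Tulcea "step_kernel G \<gamma> \<pi>" "triple_space G"
  by (rule ionescu_tulcea_steps[OF \<gamma> \<pi>])

lemma law_eq_lim: "law G \<gamma> \<pi> = IT.PF.lim"
  by (simp add: law_def)

lemma prob_space_law: "prob_space (law G \<gamma> \<pi>)"
  unfolding law_eq_lim by (rule IT.prob_space_lim)

text \<open>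
  Restricting a trajectory to \<open>{0..<m}\<close> replaces its triples from stage \<open>m\<close> on by
  \<^const>\<open>undefined\<close>, so the hypothesis on \<open>Q\<close> says that \<open>Q\<close> is decided by the stages below \<open>m\<close>.
  Such events are cylinders over a countable discrete space, which settles their measurability.
\<close>

lemma Collect_law_eq_emb:
  assumes "\<And>\<omega>. Q (restrict \<omega> {0..<m}) = Q \<omega>"
  shows "{\<omega> \<in> space (law G \<gamma> \<pi>). Q \<omega>} =
    IT.PF.emb UNIV {0..<m} {x \<in> PiE {0..<m} (triples G). Q x}"
  using assms
  by (auto simp: law_eq_lim prod_emb_def space_PiM triple_space_def PiE_iff)

lemma sets_law_Collect:
  assumes "\<And>\<omega>. Q (restrict \<omega> {0..<m}) = Q \<omega>"
  shows "{\<omega> \<in> space (law G \<gamma> \<pi>). Q \<omega>} \<in> sets (law G \<gamma> \<pi>)"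
  unfolding Collect_law_eq_emb[where Q=Q, OF assms]
  by (auto simp: law_eq_lim PiM_triple_space intro!: measurable_prod_emb)

text \<open>
  \<open>R\<close> refines an event \<open>Q\<close> by the outcome of one more stage. The kernel of stage \<open>m\<close> is
  the restriction of the distribution \<^const>\<open>step\<close> to the admissible triples, so it suffices to bound
  the latter, over admissible pasts only.
\<close>

lemma measure_law_Suc_le:
  assumes Q: "\<And>\<omega>. Q (restrict \<omega> {0..<m}) = Q \<omega>"
    and R: "\<And>\<omega>. R (restrict \<omega> {0..<Suc m}) = R \<omega>"
    and RQ: "\<And>\<omega>. R \<omega> \<Longrightarrow> Q \<omega>"
    and le: "\<And>\<omega>. (\<And>k. k < m \<Longrightarrow> \<omega> k \<in> triples G k) \<Longrightarrow> Q \<omega> \<Longrightarrow>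
      measure_pmf.prob (step G \<gamma> \<pi> m \<omega>) {y. R (fun_upd \<omega> m y)} \<le> c"
    and c: "0 \<le> c"
  shows "\<P>(\<omega> in law G \<gamma> \<pi>. R \<omega>) \<le> c * \<P>(\<omega> in law G \<gamma> \<pi>. Q \<omega>)"
proof -
  interpret law: prob_space "law G \<gamma> \<pi>"
    by (rule prob_space_law)
  have "emeasure (law G \<gamma> \<pi>) {\<omega> \<in> space (law G \<gamma> \<pi>). R \<omega>}
    \<le> ennreal c * emeasure (law G \<gamma> \<pi>) {\<omega> \<in> space (law G \<gamma> \<pi>). Q \<omega>}"
    unfolding Collect_law_eq_emb[where Q=Q, OF Q] Collect_law_eq_emb[where Q=R, OF R]
    unfolding law_eq_lim
  proof (rule IT.emeasure_lim_Suc_le)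
    fix x y
    assume x: "x \<in> space (PiM {0..<m} (triple_space G))"
      and "x(m := y) \<in> {x \<in> PiE {0..<Suc m} (triples G). R x}"
    then have "Q (restrict (x(m := y)) {0..<m})"
      using RQ[of "x(m := y)"] Q[of "x(m := y)"] by blast
    moreover have "restrict (x(m := y)) {0..<m} = x"
      using x by (auto simp: space_PiM PiE_iff extensional_def fun_eq_iff)
    ultimately show "x \<in> {x \<in> PiE {0..<m} (triples G). Q x}"
      using x by (simp add: PiM_triple_space)
  next
    fix x
    assume x: "x \<in> {x \<in> PiE {0..<m} (triples G). Q x}"
    have "emeasure (step_kernel G \<gamma> \<pi> m x)
        {y \<in> space (triple_space G m). x(m := y) \<in> {x \<in> PiE {0..<Suc m} (triples G). R x}}
      = emeasure (step G \<gamma> \<pi> m x)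
        {y \<in> triples G m. x(m := y) \<in> {x \<in> PiE {0..<Suc m} (triples G). R x}}"
      unfolding step_kernel_def triple_space_def
      by (subst emeasure_restrict_space) auto
    also have "\<dots> \<le> emeasure (step G \<gamma> \<pi> m x) {y. R (x(m := y))}"
      by (intro emeasure_mono) auto
    also have "\<dots> \<le> ennreal c"
      unfolding measure_pmf.emeasure_eq_measure
      using x by (intro ennreal_leI le) auto
    finally show "emeasure (step_kernel G \<gamma> \<pi> m x)
        {y \<in> space (triple_space G m). x(m := y) \<in> {x \<in> PiE {0..<Suc m} (triples G). R x}}
      \<le> ennreal c" .
  qed (auto simp: PiM_triple_space)
  then show ?thesis
    using c by (simp add: law.emeasure_eq_measure ennreal_mult[symmetric])
qed

end

section \<open>Survival outside the target\<close>

lemma map_fst_step_Suc: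
  "map_pmf fst (step G \<gamma> \<pi> (Suc m) \<omega>) = transition G m (state_at m \<omega>) (action_at m \<omega>)"
  by (simp add: Let_def map_bind_pmf map_pmf_def[symmetric] map_pmf_comp bind_return_pmf')

text \<open>
  The state of stage \<open>m + 1\<close> is drawn before the actions of that stage, so it has the distribution
  \<^term>\<open>transition G m i a\<close> for the triple of stage \<open>m\<close>, whatever happened before and whatever the
  policies are; survival through stage \<open>m\<close> only enters by placing \<open>i\<close> outside the target.
\<close>

lemma measure_survival_Suc_le:
  assumes \<gamma>: "\<gamma> \<in> initial_distributions G" and \<pi>: "\<pi> \<in> multipolicies G"
    and hit: "\<And>i a. i \<in> states G m - target G \<Longrightarrow> a \<in> actions G m i \<Longrightarrow>
      b \<le> measure_pmf.prob (transition G m i a) (target G)"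
    and b: "b \<le> 1" and nm: "n \<le> m"
  shows "\<P>(\<omega> in law G \<gamma> \<pi>. history_at n \<omega> = h \<and> (\<forall>k\<in>{n..Suc m}. state_at k \<omega> \<notin> target G))
    \<le> (1 - b) *
      \<P>(\<omega> in law G \<gamma> \<pi>. history_at n \<omega> = h \<and> (\<forall>k\<in>{n..m}. state_at k \<omega> \<notin> target G))"
proof (rule measure_law_Suc_le[where m = "Suc m", OF \<gamma> \<pi>])
  fix \<omega> :: "('s, 'a, 'p) trajectory"
  assume \<omega>: "\<And>k. k < Suc m \<Longrightarrow> \<omega> k \<in> triples G k"
    and surv: "history_at n \<omega> = h \<and> (\<forall>k\<in>{n..m}. state_at k \<omega> \<notin> target G)"
  let ?p = "transition G m (state_at m \<omega>) (action_at m \<omega>)"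
  have "state_at m \<omega> \<in> states G m - target G" "action_at m \<omega> \<in> actions G m (state_at m \<omega>)"
    using \<omega>[of m] surv nm by (auto simp: triples_def state_at_def action_at_def)
  then have "b \<le> measure_pmf.prob ?p (target G)"
    by (rule hit)
  then have "measure_pmf.prob ?p (- target G) \<le> 1 - b"
    using measure_pmf.prob_compl[of "target G" ?p] by (simp add: Compl_eq_Diff_UNIV)
  moreover have "measure_pmf.prob (step G \<gamma> \<pi> (Suc m) \<omega>) (fst -` (- target G))
      = measure_pmf.prob ?p (- target G)"
    by (simp only: map_fst_step_Suc[of \<gamma> \<pi> m \<omega>, symmetric] measure_map_pmf)
  moreover have "measure_pmf.prob (step G \<gamma> \<pi> (Suc m) \<omega>)
      {y. history_at n (fun_upd \<omega> (Suc m) y) = h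
        \<and> (\<forall>k\<in>{n..Suc m}. state_at k (fun_upd \<omega> (Suc m) y) \<notin> target G)}
      \<le> measure_pmf.prob (step G \<gamma> \<pi> (Suc m) \<omega>) (fst -` (- target G))"
    using nm by (intro measure_pmf.finite_measure_mono) (auto simp: state_at_def)
  ultimately show "measure_pmf.prob (step G \<gamma> \<pi> (Suc m) \<omega>)
      {y. history_at n (fun_upd \<omega> (Suc m) y) = h
        \<and> (\<forall>k\<in>{n..Suc m}. state_at k (fun_upd \<omega> (Suc m) y) \<notin> target G)} \<le> 1 - b"
    by simp
next
  fix \<omega> :: "('s, 'a, 'p) trajectory"
  show "(history_at n (restrict \<omega> {0..<Suc m}) = h
      \<and> (\<forall>k\<in>{n..m}. state_at k (restrict \<omega> {0..<Suc m}) \<notin> target G))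
    = (history_at n \<omega> = h \<and> (\<forall>k\<in>{n..m}. state_at k \<omega> \<notin> target G))"
    using nm history_at_cong[of n "restrict \<omega> {0..<Suc m}" \<omega>] by (auto simp: state_at_def)
  show "(history_at n (restrict \<omega> {0..<Suc (Suc m)}) = h
      \<and> (\<forall>k\<in>{n..Suc m}. state_at k (restrict \<omega> {0..<Suc (Suc m)}) \<notin> target G))
    = (history_at n \<omega> = h \<and> (\<forall>k\<in>{n..Suc m}. state_at k \<omega> \<notin> target G))"
    using nm history_at_cong[of n "restrict \<omega> {0..<Suc (Suc m)}" \<omega>] by (auto simp: state_at_def)
qed (use b in auto)

end

lemma hitting_time_finite_iff:
  "hitting_time G n \<omega> < \<infinity> \<longleftrightarrow> (\<exists>m\<ge>n. state_at m \<omega> \<in> target G)"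
  unfolding hitting_time_def Inf_less_iff by auto

section \<open>Hitting the target\<close>

theorem proposition1:
  fixes G :: "('s, 'a, 'p :: finite) game" and \<beta> :: "nat \<Rightarrow> real"
  assumes "stochastic_game G"
    and "\<And>n. 0 \<le> \<beta> n \<and> \<beta> n < 1"
    and "\<And>n i a. i \<in> states G n - target G \<Longrightarrow> a \<in> actions G n i \<Longrightarrow>
      measure_pmf.prob (transition G n i a) (target G) \<ge> \<beta> n"
    and "(\<Sum>n. ennreal (\<beta> n)) = \<infinity>"
  shows "\<forall>\<gamma>\<in>initial_distributions G. \<forall>\<pi>\<in>multipolicies G. \<forall>n. \<forall>h\<in>histories G n.
    last_state h \<in> states G n - target G \<longrightarrow>
    \<P>(\<omega> in law G \<gamma> \<pi>. history_at n \<omega> = h) > 0 \<longrightarrow>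
    \<P>(\<omega> in law G \<gamma> \<pi>. hitting_time G n \<omega> < \<infinity> \<bar> history_at n \<omega> = h) = 1"
proof (intro ballI allI impI)
  fix \<gamma> \<pi> n h
  assume \<gamma>: "\<gamma> \<in> initial_distributions G" and \<pi>: "\<pi> \<in> multipolicies G"
    and pos: "\<P>(\<omega> in law G \<gamma> \<pi>. history_at n \<omega> = h) > 0"
  interpret stochastic_game G by fact
  interpret law: prob_space "law G \<gamma> \<pi>"
    by (rule prob_space_law[OF \<gamma> \<pi>])
  define surv where
    "surv m = {\<omega> \<in> space (law G \<gamma> \<pi>).
      history_at n \<omega> = h \<and> (\<forall>k\<in>{n..m}. state_at k \<omega> \<notin> target G)}" for m
  have hist: "{\<omega> \<in> space (law G \<gamma> \<pi>). history_at n \<omega> = h} \<in> law.events"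
    by (rule sets_law_Collect[OF \<gamma> \<pi>, where m = "Suc n"])
      (simp add: history_at_cong[of n "restrict _ {0..<Suc n}"])
  have state: "{\<omega> \<in> space (law G \<gamma> \<pi>). state_at k \<omega> \<in> target G} \<in> law.events" for k
    by (rule sets_law_Collect[OF \<gamma> \<pi>, where m = "Suc k"]) (simp add: state_at_def)
  have [measurable]: "Measurable.pred (law G \<gamma> \<pi>) (\<lambda>\<omega>. history_at n \<omega> = h)"
    "Measurable.pred (law G \<gamma> \<pi>) (\<lambda>\<omega>. state_at k \<omega> \<in> target G)" for k
    using hist state by (simp_all add: pred_def)
  have surv_events: "surv m \<in> law.events" for m
    unfolding surv_def by measurable
  have "(\<lambda>m. law.prob (surv m)) \<longlonglongrightarrow> 0"
  proof (rule tendsto_0_if_contraction_divergent)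
    show "law.prob (surv (Suc m)) \<le> (1 - \<beta> m) * law.prob (surv m)" if "n \<le> m" for m
      unfolding surv_def
      using that assms(2)[of m] by (intro measure_survival_Suc_le \<gamma> \<pi> assms(3)) auto
    show "filterlim (\<lambda>m. \<Sum>k<m. \<beta> k) at_top sequentially"
      using assms(2,4) by (intro partial_sums_at_top_if_suminf_ennreal) auto
  qed simp
  moreover have "decseq surv"
    by (auto simp: decseq_def surv_def)
  then have "(\<lambda>m. law.prob (surv m)) \<longlonglongrightarrow> law.prob (\<Inter>m. surv m)"
    using surv_events by (intro law.finite_Lim_measure_decseq) auto
  ultimately have "law.prob (\<Inter>m. surv m) = 0"
    using LIMSEQ_unique by blast
  then have "(\<Inter>m. surv m) \<in> null_sets (law G \<gamma> \<pi>)"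
    using surv_events by (intro null_setsI) (auto simp: law.emeasure_eq_measure)
  then have "AE \<omega> in law G \<gamma> \<pi>. history_at n \<omega> = h \<longrightarrow> hitting_time G n \<omega> < \<infinity>"
    unfolding hitting_time_finite_iff by (rule AE_I') (auto simp: surv_def)
  then have "\<P>(\<omega> in law G \<gamma> \<pi>. hitting_time G n \<omega> < \<infinity> \<and> history_at n \<omega> = h)
      = \<P>(\<omega> in law G \<gamma> \<pi>. history_at n \<omega> = h)"
    unfolding hitting_time_finite_iff by (intro law.prob_eq_AE) auto
  then show "\<P>(\<omega> in law G \<gamma> \<pi>. hitting_time G n \<omega> < \<infinity> \<bar> history_at n \<omega> = h) = 1"
    using pos by (simp add: cond_prob_def)
qed

end
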